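(* Let a stationary obstacle be at distance $F\ge 0$ ahead of a vehicle whose initial speed is $V\in[0,V_L]$, and suppose that $V$ is safe with respect to $F$, i.e. $B(V)\le F$. Then the A/B policy for $F$ from speed $V$ is safe and efficient for $F$. That is, if $u:[0,\infty)\to[0,V_L]$ denotes the speed function (of time) of the A/B policy, then: (i) (safety) $F-\int_0^t u(s)\,ds\ge 0$ for all $t\ge 0$; (ii) (efficiency) increasing the speed enforced by the policy at any point compromises safety: for every continuous $w:[0,\infty)\to[0,\infty)$ with $w(t)\ge u(t)$ for all $t\ge0$ and $w(t_0)>u(t_0)$ for some $t_0\ge 0$, there is a $t\ge 0$ with $F-\int_0^t w(s)\,ds<0$.
   Context: A vehicle moves in a one-way lane with speed in $[0,V_L]$, where $V_L>0$ is its limit speed. Braking function: $B(V,v)\ge0$, defined for $0\le v\le V\le V_L$, is the distance travelled when braking from speed $V$ to speed $v$; write $B(V)=B(V,0)$. Accelerating function: $A(V,v)\ge0$, defined for $0\le V\le v\le V_L$, is the distance travelled when accelerating from speed $V$ to speed $v$. Standing properties: $B(V,V)=A(V,V)=0$; additivity $B(V,v_1)+B(v_1,v_2)=B(V,v_2)$ for $v_2\le v_1\le V$ and $A(V,v_1)+A(v_1,v_2)=A(V,v_2)$ for $V\le v_1\le v_2$; $A(V,v)$ is strictly increasing in $v$ and $B(V,v)$ is strictly decreasing in $v$. Motions: accelerating from $V$ to $v$ is a motion over a finite time interval whose speed is a continuous strictly increasing function of time from $V$ to $v$, and such that at the moment an intermediate speed $w\in[V,v]$ is reached the distance travelled is $A(V,w)$.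 Braking from $V$ to $v$ is a motion over a finite time interval whose speed is a continuous strictly decreasing function of time from $V$ to $v$, and such that at the moment an intermediate speed $w\in[v,V]$ is reached the distance travelled is $B(V,w)$. Such motions are assumed to exist for all admissible pairs of speeds (in particular $A$ and $B$ are continuous in the target speed). A/B (Accelerating/Braking) policy for a free distance $F\ge B(V)$ from speed $V$: let $$v_M=\max\{v\in[V,V_L] : A(V,v)+B(v)\le F\}.$$ The vehicle accelerates from $V$ to $v_M$; if $v_M=V_L$ and $A(V,V_L)+B(V_L)<F$, it then moves at constant speed $V_L$ for the distance $F-A(V,V_L)-B(V_L)$; finally it brakes from $v_M$ to speed $0$ and stays stopped afterwards. A policy is safe if the relative distance between the vehicle and the obstacle never becomes negative; it is efficient if increasing the speed value it enforces at any point would compromise safety. *)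

theory Defs
  imports "HOL-Analysis.Analysis"
begin

text \<open>
  A motion over the time interval \<open>[a, b]\<close> is given by its speed \<open>u\<close>, a function of time; the
  distance travelled up to time \<open>t\<close> is the integral of \<open>u\<close> over \<open>[a, t]\<close>.  If \<open>V = v\<close>, strict
  monotonicity forces \<open>a = b\<close>.
\<close>

definition accelerating_motion ::
  "(real \<Rightarrow> real \<Rightarrow> real) \<Rightarrow> real \<Rightarrow> real \<Rightarrow> real \<Rightarrow> real \<Rightarrow> (real \<Rightarrow> real) \<Rightarrow> bool"
where
  "accelerating_motion A V v a b u \<longleftrightarrow>
     a \<le> b \<and> continuous_on {a..b} u \<and> strict_mono_on {a..b} u \<and> u a = V \<and> u b = v \<and>
     (\<forall>t\<in>{a..b}. integral {a..t} u = A V (u t))"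

definition braking_motion ::
  "(real \<Rightarrow> real \<Rightarrow> real) \<Rightarrow> real \<Rightarrow> real \<Rightarrow> real \<Rightarrow> real \<Rightarrow> (real \<Rightarrow> real) \<Rightarrow> bool"
where
  "braking_motion B V v a b u \<longleftrightarrow>
     a \<le> b \<and> continuous_on {a..b} u \<and> strict_antimono_on {a..b} u \<and> u a = V \<and> u b = v \<and>
     (\<forall>t\<in>{a..b}. integral {a..t} u = B V (u t))"

text \<open>
  \<open>A\<close> and \<open>B\<close> are total functions here; they are constrained only on the speed pairs where the
  accelerating and braking distances make sense.  \<open>B V 0\<close> is the distance needed to stop.
\<close>

locale vehicle =
  fixes VL :: real and A B :: "real \<Rightarrow> real \<Rightarrow> real"
  assumes VL_pos: "VL > 0"
    and A_nonneg: "\<lbrakk>0 \<le> V; V \<le> v; v \<le> VL\<rbrakk> \<Longrightarrow> A V v \<ge> 0"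
    and B_nonneg: "\<lbrakk>0 \<le> v; v \<le> V; V \<le> VL\<rbrakk> \<Longrightarrow> B V v \<ge> 0"
    and A_refl: "V \<in> {0..VL} \<Longrightarrow> A V V = 0"
    and B_refl: "V \<in> {0..VL} \<Longrightarrow> B V V = 0"
    and A_add: "\<lbrakk>0 \<le> V; V \<le> v1; v1 \<le> v2; v2 \<le> VL\<rbrakk> \<Longrightarrow> A V v1 + A v1 v2 = A V v2"
    and B_add: "\<lbrakk>0 \<le> v2; v2 \<le> v1; v1 \<le> V; V \<le> VL\<rbrakk> \<Longrightarrow> B V v1 + B v1 v2 = B V v2"
    and A_strict_mono: "V \<in> {0..VL} \<Longrightarrow> strict_mono_on {V..VL} (A V)"
    and B_strict_antimono: "V \<in> {0..VL} \<Longrightarrow> strict_antimono_on {0..V} (B V)"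
    and accelerating_exists:
      "\<lbrakk>0 \<le> V; V \<le> v; v \<le> VL\<rbrakk> \<Longrightarrow> \<exists>T u. accelerating_motion A V v 0 T u"
    and braking_exists:
      "\<lbrakk>0 \<le> v; v \<le> V; V \<le> VL\<rbrakk> \<Longrightarrow> \<exists>T u. braking_motion B V v 0 T u"

definition AB_max_speed ::
  "real \<Rightarrow> (real \<Rightarrow> real \<Rightarrow> real) \<Rightarrow> (real \<Rightarrow> real \<Rightarrow> real) \<Rightarrow> real \<Rightarrow> real \<Rightarrow> real"
where
  "AB_max_speed VL A B F V = (GREATEST v. v \<in> {V..VL} \<and> A V v + B v 0 \<le> F)"

text \<open>
  The speed function starts at time \<open>0\<close>; its values at negative times are irrelevant.  The phases
  are acceleration on \<open>[0, t1]\<close>, constant speed on \<open>[t1, t2]\<close>, braking on \<open>[t2, t3]\<close>, and rest.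
\<close>

definition AB_policy_speed ::
  "real \<Rightarrow> (real \<Rightarrow> real \<Rightarrow> real) \<Rightarrow> (real \<Rightarrow> real \<Rightarrow> real) \<Rightarrow> real \<Rightarrow> real \<Rightarrow> (real \<Rightarrow> real) \<Rightarrow> bool"
where
  "AB_policy_speed VL A B F V u \<longleftrightarrow>
     (let vM = AB_max_speed VL A B F V in
      \<exists>t1 t2 t3.
        accelerating_motion A V vM 0 t1 u \<and>
        t1 \<le> t2 \<and>
        (if vM = VL \<and> A V VL + B VL 0 < F
         then (\<forall>t\<in>{t1..t2}. u t = VL) \<and> VL * (t2 - t1) = F - A V VL - B VL 0
         else t2 = t1) \<and>
        braking_motion B vM 0 t2 t3 u \<and>
        (\<forall>t\<ge>t3. u t = 0))"

text \<open>
  Both definitions above are well posed: the maximum defining \<open>AB_max_speed\<close> is attained, and a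
  speed function of the policy exists.
\<close>

context vehicle
begin

lemma continuous_on_A:
  assumes "V \<in> {0..VL}"
  shows "continuous_on {V..VL} (A V)"
proof -
  obtain T u where u: "accelerating_motion A V VL 0 T u"
    using accelerating_exists[of V VL] assms by auto
  then have T: "0 \<le> T" and c: "continuous_on {0..T} u" and m: "strict_mono_on {0..T} u"
    and e: "u 0 = V" "u T = VL"
    and d: "\<And>t. t \<in> {0..T} \<Longrightarrow> integral {0..t} u = A V (u t)"
    by (auto simp: accelerating_motion_def)
  have inj: "inj_on u {0..T}" using m strict_mono_on_imp_inj_on by blast
  have sub: "{V..VL} \<subseteq> u ` {0..T}"
    using IVT'[of u 0 _ T] e T c by (fastforce simp: image_iff)
  let ?g = "the_inv_into {0..T} u"
  have cg: "continuous_on (u ` {0..T}) ?g"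
    using continuous_on_inv[OF c compact_Icc] by (simp add: inj the_inv_into_f_f)
  have ci: "continuous_on {0..T} (\<lambda>t. integral {0..t} u)"
    by (rule indefinite_integral_continuous_1) (rule integrable_continuous_interval[OF c])
  have g_in: "?g ` {V..VL} \<subseteq> {0..T}"
    using sub inj by (force simp: the_inv_into_f_f)
  have "continuous_on {V..VL} (\<lambda>x. integral {0..?g x} u)"
    by (rule continuous_on_compose2[OF ci continuous_on_subset[OF cg sub] g_in])
  moreover have "integral {0..?g x} u = A V x" if "x \<in> {V..VL}" for x
  proof -
    have "?g x \<in> {0..T}" "u (?g x) = x"
      using g_in that sub f_the_inv_into_f[OF inj, of x] by blast+
    then show ?thesis using d by metis
  qed
  ultimately show ?thesis by (subst continuous_on_cong[OF refl]) auto
qed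

lemma continuous_on_B:
  assumes "V \<in> {0..VL}"
  shows "continuous_on {0..V} (B V)"
proof -
  obtain T u where u: "braking_motion B V 0 0 T u"
    using braking_exists[of 0 V] assms by auto
  then have T: "0 \<le> T" and c: "continuous_on {0..T} u" and m: "strict_antimono_on {0..T} u"
    and e: "u 0 = V" "u T = 0"
    and d: "\<And>t. t \<in> {0..T} \<Longrightarrow> integral {0..t} u = B V (u t)"
    by (auto simp: braking_motion_def)
  have inj: "inj_on u {0..T}"
    using m unfolding monotone_on_def inj_on_def by (metis less_irrefl linorder_cases)
  have sub: "{0..V} \<subseteq> u ` {0..T}"
    using IVT2'[of u T _ 0] e T c by (fastforce simp: image_iff)
  let ?g = "the_inv_into {0..T} u"
  have cg: "continuous_on (u ` {0..T}) ?g"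
    using continuous_on_inv[OF c compact_Icc] by (simp add: inj the_inv_into_f_f)
  have ci: "continuous_on {0..T} (\<lambda>t. integral {0..t} u)"
    by (rule indefinite_integral_continuous_1) (rule integrable_continuous_interval[OF c])
  have g_in: "?g ` {0..V} \<subseteq> {0..T}"
    using sub inj by (force simp: the_inv_into_f_f)
  have "continuous_on {0..V} (\<lambda>x. integral {0..?g x} u)"
    by (rule continuous_on_compose2[OF ci continuous_on_subset[OF cg sub] g_in])
  moreover have "integral {0..?g x} u = B V x" if "x \<in> {0..V}" for x
  proof -
    have "?g x \<in> {0..T}" "u (?g x) = x"
      using g_in that sub f_the_inv_into_f[OF inj, of x] by blast+
    then show ?thesis using d by metis
  qed
  ultimately show ?thesis by (subst continuous_on_cong[OF refl]) auto
qed

lemma AB_max_speed_attained: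
  assumes V: "V \<in> {0..VL}" and F: "B V 0 \<le> F"
  defines "vM \<equiv> AB_max_speed VL A B F V"
  shows "vM \<in> {V..VL}" and "A V vM + B vM 0 \<le> F"
    and "\<And>v. \<lbrakk>v \<in> {V..VL}; A V v + B v 0 \<le> F\<rbrakk> \<Longrightarrow> v \<le> vM"
proof -
  define S where "S = {v \<in> {V..VL}. A V v + B v 0 \<le> F}"
  have "continuous_on {V..VL} (\<lambda>v. A V v + (B VL 0 - B VL v))"
    using V VL_pos
    by (intro continuous_intros continuous_on_A continuous_on_subset[OF continuous_on_B[of VL]]) auto
  moreover have "B VL 0 - B VL v = B v 0" if "v \<in> {V..VL}" for v
    using B_add[of 0 v VL] that V by auto
  ultimately have "continuous_on {V..VL} (\<lambda>v. A V v + B v 0)"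
    by (subst continuous_on_cong[OF refl]) auto
  then have "closed S"
    unfolding S_def by (rule continuous_on_closed_Collect_le) auto
  then have "compact S"
    unfolding S_def by (rule compact_eq_bounded_closed[THEN iffD2, OF conjI, rotated])
      (rule bounded_subset[OF bounded_closed_interval[of V VL]], auto)
  moreover have "V \<in> S" using V F A_refl by (auto simp: S_def)
  ultimately obtain m where m: "m \<in> S" "\<And>v. v \<in> S \<Longrightarrow> v \<le> m"
    using compact_attains_sup[of S] by blast
  then have "vM = m"
    unfolding vM_def AB_max_speed_def by (intro Greatest_equality) (auto simp: S_def)
  with m show "vM \<in> {V..VL}" "A V vM + B vM 0 \<le> F"
    "\<And>v. \<lbrakk>v \<in> {V..VL}; A V v + B v 0 \<le> F\<rbrakk> \<Longrightarrow> v \<le> vM"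
    by (auto simp: S_def)
qed

lemma AB_policy_speed_exists:
  assumes V: "V \<in> {0..VL}" and F: "B V 0 \<le> F"
  shows "\<exists>u. AB_policy_speed VL A B F V u"
proof -
  define vM where "vM = AB_max_speed VL A B F V"
  have vM: "vM \<in> {V..VL}" using AB_max_speed_attained[OF V F] vM_def by auto
  obtain t1 ua where ua: "accelerating_motion A V vM 0 t1 ua"
    using accelerating_exists[of V vM] V vM by auto
  obtain T ub where ub: "braking_motion B vM 0 0 T ub"
    using braking_exists[of 0 vM] V vM by auto
  define cruise where "cruise \<longleftrightarrow> vM = VL \<and> A V VL + B VL 0 < F"
  define t2 where "t2 = (if cruise then t1 + (F - A V VL - B VL 0) / VL else t1)"
  define u where "u t = (if t \<le> t1 then ua t else if t \<le> t2 then vM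
    else if t \<le> t2 + T then ub (t - t2) else 0)" for t
  have t1: "0 \<le> t1" and T: "0 \<le> T" "ub 0 = vM" "ub T = 0" and ua1: "ua t1 = vM"
    using ua ub by (auto simp: accelerating_motion_def braking_motion_def)
  have t12: "t1 \<le> t2" using VL_pos by (auto simp: t2_def cruise_def)
  have u_a: "u t = ua t" if "t \<in> {0..t1}" for t using that by (auto simp: u_def)
  have u_b: "u t = ub (t - t2)" if "t \<in> {t2..t2 + T}" for t
    using that t12 T ua1 by (auto simp: u_def)
  have 1: "accelerating_motion A V vM 0 t1 u"
  proof -
    have "integral {0..t} u = integral {0..t} ua" if "t \<in> {0..t1}" for t
      using that u_a by (intro integral_cong) auto
    moreover have "continuous_on {0..t1} u \<longleftrightarrow> continuous_on {0..t1} ua"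
      by (rule continuous_on_cong) (auto simp: u_a)
    ultimately show ?thesis
      using ua t1 unfolding accelerating_motion_def monotone_on_def by (auto simp: u_a)
  qed
  have 2: "braking_motion B vM 0 t2 (t2 + T) u"
  proof -
    have cb: "continuous_on {0..T} ub" using ub by (simp add: braking_motion_def)
    have "continuous_on {t2..t2 + T} (\<lambda>t. ub (t - t2))"
      by (rule continuous_on_compose2[OF cb]) (auto intro!: continuous_intros)
    then have cu: "continuous_on {t2..t2 + T} u"
      by (subst continuous_on_cong[OF refl u_b]) auto
    have "integral {t2..t} u = integral {0..t - t2} ub" if t: "t \<in> {t2..t2 + T}" for t
    proof -
      have "integral {0..t - t2} ub = integral {0..t - t2} (u \<circ> (\<lambda>x. x + t2))"
        using t u_b by (intro integral_cong) auto
      also have "\<dots> = integral {0 + t2..(t - t2) + t2} u"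
        by (rule integral_shift) (rule continuous_on_subset[OF cu], use t in auto)
      finally show ?thesis by simp
    qed
    then show ?thesis
      using ub cu T unfolding braking_motion_def monotone_on_def by (auto simp: u_b)
  qed
  have 3: "if cruise then (\<forall>t\<in>{t1..t2}. u t = VL) \<and> VL * (t2 - t1) = F - A V VL - B VL 0
      else t2 = t1"
    using VL_pos ua1 by (auto simp: t2_def u_def cruise_def)
  have 4: "\<forall>t\<ge>t2 + T. u t = 0"
    using u_b T t12 by (auto simp: u_def le_less)
  show ?thesis
    unfolding AB_policy_speed_def Let_def vM_def[symmetric] cruise_def[symmetric]
    using 1 2 3 4 t12 by blast
qed

end

end

theory Submission
  imports Defs
begin

text \<open>
  Maximality of the top speed makes the policy use up the free distance: it comes to rest having
  travelled exactly \<open>F\<close>.  Since its speed is nonnegative and continuous, it never travels more than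
  \<open>F\<close>, while a continuous speed that dominates it and differs from it travels strictly more.
\<close>

text \<open>If the integrals agreed, the continuous nonnegative gap \<open>g - f\<close> would have
  integral zero and so vanish on the whole interval, including at \<open>c\<close>. On a single
  point both integrals are zero, hence \<open>a < b\<close>.\<close>

lemma integral_less_continuous:
  fixes f g :: "real \<Rightarrow> real"
  assumes f: "continuous_on {a..b} f" and g: "continuous_on {a..b} g"
    and le: "\<And>x. x \<in> {a..b} \<Longrightarrow> f x \<le> g x"
    and c: "c \<in> {a..b}" "f c < g c" and "a < b"
  shows "integral {a..b} f < integral {a..b} g"
proof (rule ccontr)
  assume "\<not> ?thesis"
  moreover have fi: "f integrable_on {a..b}" and gi: "g integrable_on {a..b}"
    using f g by (auto intro: integrable_continuous_interval)
  moreover have "integral {a..b} f \<le> integral {a..b} g"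
    using fi gi le by (rule integral_le)
  ultimately have "integral {a..b} (\<lambda>x. g x - f x) = 0"
    by (simp add: integral_diff)
  moreover have "continuous_on {a..b} (\<lambda>x. g x - f x)"
    using f g by (intro continuous_intros)
  ultimately have "g c - f c = 0"
    using integral_eq_0_iff[of a b "\<lambda>x. g x - f x"] le c \<open>a < b\<close> by auto
  with c show False by simp
qed

context vehicle
begin

text \<open>Slack at a top speed below the limit would leave room for a higher one: the total
  distance depends continuously on the top speed, so it attains \<open>F\<close> at some speed from
  \<open>vM\<close> upwards, and maximality forces that speed to be \<open>vM\<close>.\<close>

lemma AB_max_speed_less_limit_imp_eq:
  assumes V: "V \<in> {0..VL}" and F: "B V 0 \<le> F"
  defines "vM \<equiv> AB_max_speed VL A B F V"
  assumes less: "vM < VL"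
  shows "A V vM + B vM 0 = F"
proof -
  note vM = AB_max_speed_attained[OF V F, folded vM_def]
  \<comment> \<open>Continuity of \<open>B\<close> is available only in the target speed; additivity
    turns the initial speed of \<open>B v 0\<close> into a target speed.\<close>
  have "continuous_on {V..VL} (\<lambda>v. A V v + (B VL 0 - B VL v))"
    using V VL_pos
    by (intro continuous_intros continuous_on_A continuous_on_subset[OF continuous_on_B[of VL]]) auto
  moreover have "B VL 0 - B VL v = B v 0" if "v \<in> {V..VL}" for v
    using B_add[of 0 v VL] that V by auto
  ultimately have "continuous_on {V..VL} (\<lambda>v. A V v + B v 0)"
    by (subst continuous_on_cong[OF refl]) auto
  then have "continuous_on {vM..VL} (\<lambda>v. A V v + B v 0)"
    by (rule continuous_on_subset) (use vM(1) in auto)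
  \<comment> \<open>Otherwise \<open>VL\<close> would be an admissible top speed exceeding
    \<open>vM\<close>.\<close>
  moreover have "F \<le> A V VL + B VL 0"
    using vM(3)[of VL] V less by (meson atLeastAtMost_iff le_cases not_le order_refl)
  ultimately obtain x where x: "vM \<le> x" "x \<le> VL" "A V x + B x 0 = F"
    using IVT'[of "\<lambda>v. A V v + B v 0" vM F VL] vM(2) less by auto
  then have "x = vM"
    using vM(1) vM(3)[of x] by auto
  with x show ?thesis by simp
qed

text \<open>Reduces the policy to what safety and efficiency rest on; the witness for
  \<open>T\<close> is the end \<open>t3\<close> of braking.\<close>

lemma AB_policy_speed_profile:
  assumes V: "V \<in> {0..VL}" and F: "B V 0 \<le> F" and u: "AB_policy_speed VL A B F V u"
  obtains T where "0 \<le> T" "continuous_on {0..} u" "\<And>t. 0 \<le> t \<Longrightarrow> 0 \<le> u t"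
    "\<And>t. T \<le> t \<Longrightarrow> integral {0..t} u = F"
proof -
  define vM where "vM = AB_max_speed VL A B F V"
  define cruise where "cruise \<longleftrightarrow> vM = VL \<and> A V VL + B VL 0 < F"
  note vM = AB_max_speed_attained[OF V F, folded vM_def]
  obtain t1 t2 t3 where acc: "accelerating_motion A V vM 0 t1 u" and t12: "t1 \<le> t2"
    and mid: "if cruise then (\<forall>t\<in>{t1..t2}. u t = VL) \<and> VL * (t2 - t1) = F - A V VL - B VL 0
      else t2 = t1"
    and brk: "braking_motion B vM 0 t2 t3 u" and rest: "\<And>t. t3 \<le> t \<Longrightarrow> u t = 0"
    using u unfolding AB_policy_speed_def Let_def vM_def[symmetric] cruise_def[symmetric] by blast
  have t1: "0 \<le> t1" and c1: "continuous_on {0..t1} u" and m1: "strict_mono_on {0..t1} u"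
    and u0: "u 0 = V" and ut1: "u t1 = vM" and i1: "integral {0..t1} u = A V vM"
    using acc by (auto simp: accelerating_motion_def)
  have t23: "t2 \<le> t3" and c3: "continuous_on {t2..t3} u" and m3: "strict_antimono_on {t2..t3} u"
    and ut3: "u t3 = 0" and i3: "integral {t2..t3} u = B vM 0"
    using brk by (auto simp: braking_motion_def)
  \<comment> \<open>Without cruising the interval is the single point \<open>t1\<close>, so both
    variants of the policy can be treated alike.\<close>
  have u_mid: "u t = vM" if "t \<in> {t1..t2}" for t
    using mid ut1 that by (auto simp: cruise_def split: if_splits)
  have c2: "continuous_on {t1..t2} u"
    by (subst continuous_on_cong[OF refl u_mid]) auto
  have i2: "integral {t1..t2} u = F - A V vM - B vM 0"
  proof -
    have "integral {t1..t2} u = integral {t1..t2} (\<lambda>_. vM)"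
      by (intro integral_cong u_mid)
    also have "\<dots> = vM * (t2 - t1)" using t12 by simp
    also have "\<dots> = F - A V vM - B vM 0"
    proof (cases cruise)
      case True
      then show ?thesis using mid by (simp add: cruise_def)
    next
      \<comment> \<open>The middle phase now covers no distance, so acceleration and braking alone
        must use up \<open>F\<close>. Below the limit speed this is maximality; at the limit speed
        it is the failure of the strict inequality in \<open>cruise\<close>.\<close>
      case False
      have "A V vM + B vM 0 = F"
      proof (cases "vM < VL")
        case True
        then show ?thesis using AB_max_speed_less_limit_imp_eq[OF V F] by (simp add: vM_def)
      next
        assume "\<not> vM < VL"
        then have "vM = VL" using vM(1) by auto
        then show ?thesis using False vM(2) by (auto simp: cruise_def)
      qed
      then show ?thesis using False mid by simp
    qed
    finally show ?thesis .
  qed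
  have c4: "continuous_on {t3..} u"
    by (subst continuous_on_cong[OF refl rest]) auto
  \<comment> \<open>The phases are closed and share their endpoints, so continuity on each one
    pastes together.\<close>
  have "continuous_on ((({0..t1} \<union> {t1..t2}) \<union> {t2..t3}) \<union> {t3..}) u"
    using c1 c2 c3 c4 by (intro continuous_on_closed_Un closed_Un) auto
  moreover have "{0..} = (({0..t1} \<union> {t1..t2}) \<union> {t2..t3}) \<union> {t3..}"
    using t1 t12 t23 by auto
  ultimately have cu: "continuous_on {0..} u" by simp
  have ui: "u integrable_on {a..b}" if "0 \<le> a" for a b
    by (rule integrable_continuous_interval[OF continuous_on_subset[OF cu]]) (use that in auto)
  have nonneg: "0 \<le> u t" if "0 \<le> t" for t
  proof -
    consider "t \<le> t1" | "t \<in> {t1..t2}" | "t \<in> {t2..t3}" | "t3 \<le> t"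
      using \<open>0 \<le> t\<close> by fastforce
    then show ?thesis
    proof cases
      case 1
      then show ?thesis
        using monotone_onD[OF m1, of 0 t] that u0 V t1 by (cases "t = 0") auto
    next
      case 2
      then show ?thesis using u_mid vM(1) V by auto
    next
      case 3
      then show ?thesis
        using monotone_onD[OF m3, of t t3] t23 ut3 by (cases "t = t3") auto
    next
      case 4
      then show ?thesis using rest by simp
    qed
  qed
  have "integral {0..t} u = F" if t: "t3 \<le> t" for t
  proof -
    note combine = Henstock_Kurzweil_Integration.integral_combine
    have "integral {t3..t} u = integral {t3..t} (\<lambda>_. 0)"
      using rest by (intro integral_cong) auto
    moreover have "integral {0..t1} u + integral {t1..t2} u = integral {0..t2} u"
      using t1 t12 ui by (intro combine) auto
    moreover have "integral {0..t2} u + integral {t2..t3} u = integral {0..t3} u"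
      using t1 t12 t23 ui by (intro combine) auto
    moreover have "integral {0..t3} u + integral {t3..t} u = integral {0..t} u"
      using t1 t12 t23 t ui by (intro combine) auto
    ultimately show ?thesis using i1 i2 i3 by simp
  qed
  moreover have "0 \<le> t3" using t1 t12 t23 by simp
  ultimately show ?thesis using that cu nonneg by blast
qed

end

theorem theorem2:
  fixes VL F V :: real
    and A B :: "real \<Rightarrow> real \<Rightarrow> real"
    and u :: "real \<Rightarrow> real"
  assumes "vehicle VL A B"
    and "F \<ge> 0"
    and "V \<in> {0..VL}"
    and "B V 0 \<le> F"
    and "AB_policy_speed VL A B F V u"
  shows "(\<forall>t\<ge>0. F - integral {0..t} u \<ge> 0) \<and>
         (\<forall>w :: real \<Rightarrow> real.
            continuous_on {0..} w \<and> (\<forall>t\<ge>0. w t \<ge> 0) \<and>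
            (\<forall>t\<ge>0. w t \<ge> u t) \<and> (\<exists>t0\<ge>0. w t0 > u t0) \<longrightarrow>
            (\<exists>t\<ge>0. F - integral {0..t} w < 0))"
proof -
  interpret vehicle VL A B by fact
  obtain T where T: "0 \<le> T" and cu: "continuous_on {0..} u"
    and nonneg: "\<And>t. 0 \<le> t \<Longrightarrow> 0 \<le> u t"
    and total: "\<And>t. T \<le> t \<Longrightarrow> integral {0..t} u = F"
    using AB_policy_speed_profile[OF assms(3-5)] by blast
  have cont: "continuous_on {0..t} f" if "continuous_on {0..} f" for f :: "real \<Rightarrow> real" and t
    by (rule continuous_on_subset[OF that]) auto
  have safe: "integral {0..t} u \<le> F" if "0 \<le> t" for t
  proof -
    \<comment> \<open>The distance travelled never decreases, so it is bounded by its value at a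
      time after the stop.\<close>
    have "integral {0..t} u \<le> integral {0..max t T} u"
      using that nonneg cont[OF cu]
      by (intro integral_subset_le integrable_continuous_interval) auto
    then show ?thesis using total by simp
  qed
  have efficient: "\<exists>t\<ge>0. F - integral {0..t} w < 0"
    if cw: "continuous_on {0..} w" and le: "\<forall>t\<ge>0. u t \<le> w t" and t0: "0 \<le> t0" "u t0 < w t0"
    for w :: "real \<Rightarrow> real" and t0
  proof -
    \<comment> \<open>Late enough that \<open>u\<close> has covered \<open>F\<close> and that
      \<open>t0\<close> lies in the interval; the \<open>+ 1\<close> keeps the interval
      nondegenerate even if \<open>T\<close> and \<open>t0\<close> are both 0.\<close>
    define t where "t = max T (t0 + 1)"
    have "integral {0..t} u < integral {0..t} w"
      using le t0 by (intro integral_less_continuous[where c = t0] cont cu cw) (auto simp: t_def)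
    moreover have "integral {0..t} u = F" "0 \<le> t"
      using total T by (auto simp: t_def)
    ultimately show ?thesis by auto
  qed
  show ?thesis using safe efficient by auto
qed

end
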